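(* Let $d,m\ge 1$ and $0\le p\le m$ be integers with $p+d\ge m$, let $\alpha\in(0,1]$, and let $W\subset\mathbb{R}^m$ be a global $\mathcal{C}^1$ manifold of dimension $p$ (in the sense specified in the context). Then there exists a constant $C_W>0$ depending only on $W$ (for the fixed $d$ and $\alpha$; in particular independent of $g$ and $\varepsilon$) such that for every $g\in\mathcal{C}^{\alpha}([0,1]^d,\mathbb{R}^m)$ (H\"older continuous with exponent $\alpha$) and every sufficiently small $\varepsilon>0$, $$\mathcal{N}^g_W(\varepsilon)\;\le\; C_W\cdot\left(\frac{\|g\|_{\mathcal{C}^{0,\alpha}}}{\varepsilon}\right)^{\frac{m-p}{\alpha}}.$$
   Context: $|\cdot|$ is the Euclidean norm, $B_m(W,r)=\bigcup_{a\in W}\{x\in\mathbb{R}^m:|x-a|<r\}$, and $\mathcal{H}^s$ is the $s$-dimensional Hausdorff measure. Standing assumption on $W$ ("global $\mathcal{C}^1$ manifold" of dimension $p$): for some $r>0$ there is a $\mathcal{C}^1$ diffeomorphism $\varphi:B_m(W,r)\to\varphi(B_m(W,r))\subseteq\mathbb{R}^m$ with $\varphi(W)\subseteq\mathbb{R}^p\times\{0\}\subseteq\mathbb{R}^p\times\mathbb{R}^{m-p}$ and $$0<\inf_{x\ne y}\frac{|\varphi(x)-\varphi(y)|}{|x-y|}\le\sup_{x\neq y}\frac{|\varphi(x)-\varphi(y)|}{|x-y|}<\infty ,$$ where $x,y$ range over $B_m(W,r)$. (The manifold $W$ is regarded as given together with $r$ and $\varphi$.) For $h\in\mathcal{C}([0,1]^d,\mathbb{R}^m)$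 put $\mathcal{Z}^h_W=\{x\in[0,1]^d:h(x)\in W\}$. For $g\in\mathcal{C}([0,1]^d,\mathbb{R}^m)$ and $\varepsilon>0$, $$\mathcal{N}^g_W(\varepsilon):=\inf\left\{\mathcal{H}^{d+p-m}(\mathcal{Z}^h_W):\ h\in\mathcal{C}([0,1]^d,\mathbb{R}^m),\ \|h-g\|_{\mathcal{C}^0}\le\varepsilon\right\},$$ where $\|\cdot\|_{\mathcal{C}^0}$ is the sup norm. The H\"older norm used is $\|g\|_{\mathcal{C}^{0,\alpha}}=\sup_{x\neq y}\frac{|g(x)-g(y)|}{|x-y|^\alpha}$. *)

theory Defs
  imports "HOL-Analysis.Analysis"
begin

text \<open>
  The real power for base \<open>x \<ge> 0\<close> with the convention \<open>0\<^sup>0 = 1\<close>; in the library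
  \<open>0 powr 0 = 0\<close>, which would make the zero-dimensional Hausdorff measure of a point vanish.
\<close>

definition rpow :: "real \<Rightarrow> real \<Rightarrow> real" where
  "rpow x a = (if a = 0 then 1 else x powr a)"

text \<open>
  Hausdorff measure as an outer measure on all subsets, in the usual normalisation:
  \<open>\<H>\<^sup>0\<close> is the counting measure and \<open>\<H>\<^sup>n\<close> on \<open>n\<close>-dimensional Euclidean space is Lebesgue
  measure. Boundedness of the covering sets has to be required since \<^const>\<open>diameter\<close> is
  unspecified on unbounded sets.
\<close>

definition hausdorff_weight :: "real \<Rightarrow> 'a::metric_space set \<Rightarrow> ennreal" where
  "hausdorff_weight s E =
     (if E = {} then 0 else ennreal (unit_ball_vol s * rpow (diameter E / 2) s))"

definition hausdorff_premeasure :: "real \<Rightarrow> real \<Rightarrow> 'a::metric_space set \<Rightarrow> ennreal" where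
  "hausdorff_premeasure s \<delta> A =
     (INF E \<in> {E :: nat \<Rightarrow> 'a set. A \<subseteq> (\<Union>i. E i) \<and> (\<forall>i. bounded (E i) \<and> diameter (E i) \<le> \<delta>)}.
        \<Sum>i. hausdorff_weight s (E i))"

definition hausdorff_measure :: "real \<Rightarrow> 'a::metric_space set \<Rightarrow> ennreal" where
  "hausdorff_measure s A = (SUP \<delta> \<in> {0<..}. hausdorff_premeasure s \<delta> A)"

definition nbhd :: "'a::metric_space set \<Rightarrow> real \<Rightarrow> 'a set" where
  "nbhd W r = (\<Union>a\<in>W. ball a r)"

definition C1_on :: "'a::real_normed_vector set \<Rightarrow> ('a \<Rightarrow> 'b::real_normed_vector) \<Rightarrow> bool" where
  "C1_on U f \<longleftrightarrow> (\<exists>f' :: 'a \<Rightarrow> 'a \<Rightarrow>\<^sub>L 'b.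
     (\<forall>x\<in>U. (f has_derivative blinfun_apply (f' x)) (at x)) \<and> continuous_on U f')"

definition C1_diffeo_on :: "'a::real_normed_vector set \<Rightarrow> ('a \<Rightarrow> 'b::real_normed_vector) \<Rightarrow> bool" where
  "C1_diffeo_on U f \<longleftrightarrow> open U \<and> open (f ` U) \<and> inj_on f U \<and>
     C1_on U f \<and> C1_on (f ` U) (inv_into U f)"

text \<open>
  The index type \<open>'m\<close> carries no order, so \<open>\<real>\<^sup>p \<times> {0}\<close> is the coordinate subspace spanned by
  some \<open>p\<close> of the coordinates; which ones is immaterial, since \<open>\<phi>\<close> may be composed with a
  permutation of coordinates. The infimum and supremum are taken in \<open>[0,\<infinity>]\<close>.
\<close>

definition global_C1_manifold ::
  "nat \<Rightarrow> (real^'m) set \<Rightarrow> real \<Rightarrow> (real^'m \<Rightarrow> real^'m) \<Rightarrow> bool" where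
  "global_C1_manifold p W r \<phi> \<longleftrightarrow>
     r > 0 \<and>
     C1_diffeo_on (nbhd W r) \<phi> \<and>
     (\<exists>P :: 'm set. card P = p \<and> \<phi> ` W \<subseteq> {y. \<forall>i. i \<notin> P \<longrightarrow> y $ i = 0}) \<and>
     0 < (INF (x, y) \<in> {(x, y). x \<in> nbhd W r \<and> y \<in> nbhd W r \<and> x \<noteq> y}.
            ennreal (norm (\<phi> x - \<phi> y) / norm (x - y))) \<and>
     (SUP (x, y) \<in> {(x, y). x \<in> nbhd W r \<and> y \<in> nbhd W r \<and> x \<noteq> y}.
            ennreal (norm (\<phi> x - \<phi> y) / norm (x - y))) < \<infinity>"

abbreviation unit_cube :: "(real^'d) set" where
  "unit_cube \<equiv> cbox 0 1"

definition cube_sup_norm :: "(real^'d \<Rightarrow> real^'m) \<Rightarrow> real" where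
  "cube_sup_norm f = (SUP x \<in> unit_cube. norm (f x))"

definition holder_continuous :: "real \<Rightarrow> (real^'d \<Rightarrow> real^'m) \<Rightarrow> bool" where
  "holder_continuous \<alpha> g \<longleftrightarrow>
     (\<exists>L. \<forall>x\<in>unit_cube. \<forall>y\<in>unit_cube. norm (g x - g y) \<le> L * norm (x - y) powr \<alpha>)"

definition holder_norm :: "real \<Rightarrow> (real^'d \<Rightarrow> real^'m) \<Rightarrow> real" where
  "holder_norm \<alpha> g =
     (SUP (x, y) \<in> {(x, y). x \<in> unit_cube \<and> y \<in> unit_cube \<and> x \<noteq> y}.
        norm (g x - g y) / norm (x - y) powr \<alpha>)"

definition preimage_set :: "(real^'m) set \<Rightarrow> (real^'d \<Rightarrow> real^'m) \<Rightarrow> (real^'d) set" where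
  "preimage_set W h = {x \<in> unit_cube. h x \<in> W}"

text \<open>Functions on the cube are represented by total functions, whose values outside are ignored.\<close>

definition min_preimage_measure ::
  "nat \<Rightarrow> (real^'m) set \<Rightarrow> (real^'d \<Rightarrow> real^'m) \<Rightarrow> real \<Rightarrow> ennreal" where
  "min_preimage_measure p W g \<epsilon> =
     (INF h \<in> {h. continuous_on unit_cube h \<and> cube_sup_norm (\<lambda>x. h x - g x) \<le> \<epsilon>}.
        hausdorff_measure (real CARD('d) + real p - real CARD('m)) (preimage_set W h))"

end

theory Submission
  imports Defs
begin

text \<open>
  A Hoelder function \<open>g\<close> is within \<open>\<epsilon>/2\<close> of a Lipschitz function \<open>f\<close> whose constant is of order
  \<open>\<epsilon> (\<parallel>g\<parallel>/\<epsilon>)\<^bsup>1/\<alpha>\<^esup>\<close>. Among the translates \<open>f + v\<close> with \<open>\<bar>v\<bar> < \<epsilon>/2\<close>, one whose preimage of \<open>W\<close> is no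
  larger than twice the average does the job. The average is controlled as in Eilenberg's
  inequality: cover the cube by a fine grid, note that a cell meets the preimage only if \<open>f + v\<close>
  maps its corner into a thin tube around \<open>W\<close>, bound the volume of such \<open>v\<close> with the
  bi-Lipschitz chart, and let the mesh tend to \<open>0\<close> with Fatou's lemma. If \<open>g\<close> is constant and
  \<open>p < m\<close>, the bound holds with every positive number in place of the Hoelder norm, hence the
  infimum is \<open>0\<close>.
\<close>

section \<open>Upper bounds for Hausdorff measure from finite covers\<close>

lemma rpow_of_nat: "0 \<le> x \<Longrightarrow> rpow x (real n) = x ^ n"
  by (cases "x = 0") (auto simp: rpow_def powr_realpow)

lemma hausdorff_premeasure_le_sum:
  fixes E :: "'i \<Rightarrow> 'a::metric_space set"
  assumes "finite I" "A \<subseteq> (\<Union>i\<in>I. E i)" "0 \<le> \<delta>"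
    and E: "\<And>i. i \<in> I \<Longrightarrow> bounded (E i) \<and> diameter (E i) \<le> \<delta>"
  shows "hausdorff_premeasure s \<delta> A \<le> (\<Sum>i\<in>I. hausdorff_weight s (E i))"
proof -
  obtain b where b: "bij_betw b {0..<card I} I"
    using ex_bij_betw_nat_finite[OF \<open>finite I\<close>] by blast
  \<comment> \<open>Padding with the empty set is free: its weight is 0 even for
    \<open>s = 0\<close>, where every nonempty set has weight 1.\<close>
  define F where "F i = (if i < card I then E (b i) else {})" for i
  have bI: "b i \<in> I" if "i < card I" for i
    using b that by (auto simp: bij_betw_def)
  have "A \<subseteq> (\<Union>i. F i)"
  proof
    fix x assume "x \<in> A"
    then obtain i where "i \<in> I" "x \<in> E i" using assms by auto
    moreover have "i \<in> b ` {0..<card I}"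
      using b \<open>i \<in> I\<close> by (simp add: bij_betw_def)
    then obtain k where "k < card I" "b k = i" by auto
    ultimately show "x \<in> (\<Union>i. F i)" by (auto simp: F_def intro!: exI[of _ k])
  qed
  moreover have "bounded (F i) \<and> diameter (F i) \<le> \<delta>" for i
    using E[OF bI] \<open>0 \<le> \<delta>\<close> by (auto simp: F_def)
  ultimately have "hausdorff_premeasure s \<delta> A \<le> (\<Sum>i. hausdorff_weight s (F i))"
    unfolding hausdorff_premeasure_def by (intro INF_lower) auto
  also have "\<dots> = (\<Sum>i\<in>{0..<card I}. hausdorff_weight s (F i))"
    by (rule suminf_finite) (auto simp: F_def hausdorff_weight_def)
  also have "\<dots> = (\<Sum>i\<in>{0..<card I}. hausdorff_weight s (E (b i)))"
    by (intro sum.cong) (auto simp: F_def)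
  also have "\<dots> = (\<Sum>i\<in>I. hausdorff_weight s (E i))"
    by (rule sum.reindex_bij_betw[OF b])
  finally show ?thesis .
qed

text \<open>Refining the scale leaves fewer admissible covers, so the premeasure at a fixed scale
  \<eta> is eventually at most \<open>u N\<close>. A liminf is the form of bound to which Fatou's
  lemma applies.\<close>

lemma hausdorff_measure_le_liminf:
  assumes "(\<lambda>N. \<delta> N) \<longlonglongrightarrow> 0"
    and "\<forall>\<^sub>F N in sequentially. hausdorff_premeasure s (\<delta> N) A \<le> u N"
  shows "hausdorff_measure s A \<le> liminf u"
  unfolding hausdorff_measure_def
proof (rule SUP_least)
  fix \<eta> :: real assume "\<eta> \<in> {0<..}"
  then have "\<forall>\<^sub>F N in sequentially. \<delta> N < \<eta>"
    using assms(1) by (auto intro: order_tendstoD)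
  then have "\<forall>\<^sub>F N in sequentially. hausdorff_premeasure s \<eta> A \<le> u N"
    using assms(2)
  proof eventually_elim
    case (elim N)
    have "hausdorff_premeasure s \<eta> A \<le> hausdorff_premeasure s (\<delta> N) A"
      unfolding hausdorff_premeasure_def using elim(1)
      by (intro INF_superset_mono) (auto intro: order_trans less_imp_le)
    with elim(2) show ?case by order
  qed
  then show "hausdorff_premeasure s \<eta> A \<le> liminf u"
    by (rule Liminf_bounded)
qed

section \<open>Lipschitz approximation of Hoelder functions\<close>

text \<open>The infimal convolution of \<open>g\<close> with a cone whose slope is the one at which the
  Hoelder modulus exceeds the cone by at most \<open>\<epsilon>\<close>.\<close>

lemma lipschitz_approx_of_holder:
  fixes g :: "'a::metric_space \<Rightarrow> real"
  assumes "0 < L" "0 < \<epsilon>" "0 < \<alpha>" "\<alpha> \<le> 1"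
    and g: "\<And>x y. x \<in> S \<Longrightarrow> y \<in> S \<Longrightarrow> \<bar>g x - g y\<bar> \<le> L * dist x y powr \<alpha>"
  obtains f where "(\<epsilon> * (L / \<epsilon>) powr (1 / \<alpha>))-lipschitz_on S f"
    and "\<And>x. x \<in> S \<Longrightarrow> \<bar>f x - g x\<bar> \<le> \<epsilon>"
proof -
  \<comment> \<open>At distance \<open>t0\<close> the modulus \<open>L * t powr \<alpha>\<close>
    equals \<epsilon>, and so does \<open>K * t\<close>: the cone and the modulus cross
    there.\<close>
  define t0 where "t0 = (\<epsilon> / L) powr (1 / \<alpha>)"
  define K where "K = \<epsilon> * (L / \<epsilon>) powr (1 / \<alpha>)"
  define f where "f x = (INF y\<in>S. g y + K * dist x y)" for x
  have t0: "t0 > 0" and K0: "K > 0" using assms by (auto simp: t0_def K_def)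
  have K: "K = \<epsilon> / t0"
    using assms by (simp add: K_def t0_def powr_divide)
  have Lt: "L * t0 powr \<alpha> = \<epsilon>"
    using assms by (simp add: t0_def powr_powr)
  \<comment> \<open>Up to \<open>t0\<close> the modulus is at most \<epsilon>; beyond it,
    \<open>t / t0 \<ge> 1\<close> and \<open>\<alpha> \<le> 1\<close> bring it down to at most
    \<open>K * t\<close>.\<close>
  have key: "L * t powr \<alpha> \<le> \<epsilon> + K * t" if "0 \<le> t" for t
  proof (cases "t \<le> t0")
    case True
    have "L * t powr \<alpha> \<le> L * t0 powr \<alpha>"
      using True that assms by (intro mult_left_mono powr_mono2) auto
    also have "\<dots> \<le> \<epsilon> + K * t" using Lt K0 that by simp
    finally show ?thesis .
  next
    case False
    have "L * t powr \<alpha> = L * t0 powr \<alpha> * (t / t0) powr \<alpha>"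
      using False t0 by (simp add: powr_divide)
    also have "\<dots> = \<epsilon> * (t / t0) powr \<alpha>" by (simp add: Lt)
    also have "\<dots> \<le> \<epsilon> * (t / t0) powr 1"
      using False t0 assms by (intro mult_left_mono powr_mono) auto
    also have "\<dots> = K * t" using False t0 by (simp add: K)
    finally show ?thesis using assms by simp
  qed
  \<comment> \<open>Serves twice: it makes the infimum defining \<open>f\<close> finite, and it
    gives \<open>g x - \<epsilon> \<le> f x\<close>.\<close>
  have low: "g x - \<epsilon> \<le> g y + K * dist x y" if "x \<in> S" "y \<in> S" for x y
    using g[OF that] key[of "dist x y"] by auto
  have bdd: "bdd_below ((\<lambda>y. g y + K * dist x y) ` S)" if "x \<in> S" for x
    using low[OF that] by (auto intro!: bdd_belowI2)
  have half: "f x \<le> f y + K * dist x y" if "x \<in> S" "y \<in> S" for x y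
  proof -
    have "f x - K * dist x y \<le> g z + K * dist y z" if "z \<in> S" for z
    proof -
      have "f x \<le> g z + K * dist x z"
        unfolding f_def using bdd \<open>x \<in> S\<close> that by (intro cINF_lower) auto
      also have "\<dots> \<le> g z + K * (dist x y + dist y z)"
        using K0 dist_triangle by (intro add_left_mono mult_left_mono) auto
      finally show ?thesis by (simp add: algebra_simps)
    qed
    then have "f x - K * dist x y \<le> f y"
      unfolding f_def[of y] using that by (intro cINF_greatest) auto
    then show ?thesis by simp
  qed
  have "K-lipschitz_on S f"
    using half K0 by (intro lipschitz_onI) (force simp: dist_real_def dist_commute abs_le_iff)+
  moreover have "\<bar>f x - g x\<bar> \<le> \<epsilon>" if "x \<in> S" for x
  proof -
    have "f x \<le> g x + K * dist x x"
      unfolding f_def using bdd that by (intro cINF_lower) auto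
    moreover have "g x - \<epsilon> \<le> f x"
      unfolding f_def using that low by (intro cINF_greatest) auto
    ultimately show ?thesis using assms by (auto simp: abs_le_iff)
  qed
  ultimately show ?thesis using that by (simp add: K_def)
qed

text \<open>Coordinatewise approximation with accuracy \<open>\<epsilon> / CARD('m)\<close>: the
  norm is at most the sum of the absolute coordinates, so errors and Lipschitz constants add up. The
  smaller accuracy puts the factor \<open>CARD('m)\<close> inside the power.\<close>

lemma lipschitz_approx_of_holder_cart:
  fixes g :: "'a::metric_space \<Rightarrow> real^'m"
  assumes "0 < L" "0 < \<epsilon>" "0 < \<alpha>" "\<alpha> \<le> 1"
    and g: "\<And>x y. x \<in> S \<Longrightarrow> y \<in> S \<Longrightarrow> norm (g x - g y) \<le> L * dist x y powr \<alpha>"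
  obtains f where "(\<epsilon> * (real CARD('m) * L / \<epsilon>) powr (1 / \<alpha>))-lipschitz_on S f"
    and "\<And>x. x \<in> S \<Longrightarrow> norm (f x - g x) \<le> \<epsilon>"
proof -
  define \<epsilon>' where "\<epsilon>' = \<epsilon> / CARD('m)"
  define K where "K = \<epsilon>' * (L / \<epsilon>') powr (1 / \<alpha>)"
  have "\<epsilon>' > 0" using assms by (simp add: \<epsilon>'_def)
  have "\<exists>f. K-lipschitz_on S f \<and> (\<forall>x\<in>S. \<bar>f x - g x $ i\<bar> \<le> \<epsilon>')" for i
  proof -
    have "\<bar>g x $ i - g y $ i\<bar> \<le> L * dist x y powr \<alpha>" if "x \<in> S" "y \<in> S" for x y
      using component_le_norm_cart[of "g x - g y" i] g[OF that] by simp
    then show ?thesis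
      using lipschitz_approx_of_holder[OF \<open>0 < L\<close> \<open>\<epsilon>' > 0\<close> assms(3,4), of S "\<lambda>x. g x $ i"]
      unfolding K_def by metis
  qed
  then obtain F where F: "\<And>i. K-lipschitz_on S (F i)"
      "\<And>i x. x \<in> S \<Longrightarrow> \<bar>F i x - g x $ i\<bar> \<le> \<epsilon>'"
    by metis
  define f where "f x = (\<chi> i. F i x)" for x
  have K0: "0 \<le> K" using \<open>\<epsilon>' > 0\<close> by (simp add: K_def)
  have "dist (f x) (f y) \<le> CARD('m) * K * dist x y" if "x \<in> S" "y \<in> S" for x y
  proof -
    have "dist (f x) (f y) \<le> (\<Sum>i\<in>UNIV. \<bar>(f x - f y) $ i\<bar>)"
      unfolding dist_norm by (rule norm_le_l1_cart)
    also have "\<dots> \<le> (\<Sum>i\<in>(UNIV::'m set). K * dist x y)"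
      using lipschitz_onD[OF F(1) that] by (intro sum_mono) (simp add: f_def dist_real_def)
    finally show ?thesis by (simp add: mult.assoc)
  qed
  then have "(CARD('m) * K)-lipschitz_on S f"
    using K0 by (intro lipschitz_onI) auto
  moreover have "norm (f x - g x) \<le> \<epsilon>" if "x \<in> S" for x
  proof -
    have "norm (f x - g x) \<le> (\<Sum>i\<in>UNIV. \<bar>(f x - g x) $ i\<bar>)"
      by (rule norm_le_l1_cart)
    also have "\<dots> \<le> (\<Sum>i\<in>(UNIV::'m set). \<epsilon>')"
      using F(2)[OF that] by (intro sum_mono) (simp add: f_def)
    finally show ?thesis by (simp add: \<epsilon>'_def)
  qed
  ultimately show ?thesis using that by (simp add: K_def \<epsilon>'_def mult_ac)
qed

section \<open>Volume bounds by counting\<close>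

text \<open>Pick one representative for each value of \<open>q\<close>; the balls of radius
  \<open>R\<close> around these points cover \<open>A\<close>.\<close>

lemma emeasure_le_card_fibres:
  fixes A :: "'a::euclidean_space set"
  assumes "finite I" "q ` A \<subseteq> I" "0 \<le> R"
    and q: "\<And>v w. v \<in> A \<Longrightarrow> w \<in> A \<Longrightarrow> q v = q w \<Longrightarrow> dist v w \<le> R"
  shows "emeasure lborel A \<le> ennreal (real (card I) * (unit_ball_vol (DIM('a)) * R ^ DIM('a)))"
proof -
  \<comment> \<open>At values not taken by \<open>q\<close> on \<open>A\<close> this is an arbitrary
    point, whose ball merely enlarges the cover.\<close>
  define c where "c i = (SOME v. v \<in> A \<and> q v = i)" for i
  have c: "c (q v) \<in> A \<and> q (c (q v)) = q v" if "v \<in> A" for v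
    using that someI[of "\<lambda>w. w \<in> A \<and> q w = q v" v] by (simp add: c_def)
  have "A \<subseteq> (\<Union>i\<in>I. cball (c i) R)"
  proof
    fix v assume v: "v \<in> A"
    then have "q v \<in> I" using assms(2) by auto
    moreover have "v \<in> cball (c (q v)) R" using q[of "c (q v)" v] c[OF v] v by simp
    ultimately show "v \<in> (\<Union>i\<in>I. cball (c i) R)" by blast
  qed
  then have "emeasure lborel A \<le> emeasure lborel (\<Union>i\<in>I. cball (c i) R)"
    using \<open>finite I\<close> by (intro emeasure_mono) auto
  also have "\<dots> \<le> (\<Sum>i\<in>I. emeasure lborel (cball (c i) R))"
    using \<open>finite I\<close> by (intro emeasure_subadditive_finite) auto
  also have "\<dots> = ennreal (real (card I) * (unit_ball_vol (DIM('a)) * R ^ DIM('a)))"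
    using \<open>0 \<le> R\<close> by (simp add: emeasure_cball ennreal_mult' ennreal_of_nat_eq_real_of_nat)
  finally show ?thesis .
qed

lemma card_floor_interval:
  fixes a b :: real
  assumes "a \<le> b"
  shows "real (card {\<lfloor>a\<rfloor>..\<lfloor>b\<rfloor>}) \<le> b - a + 2"
  using floor_mono[OF assms] by simp linarith

lemma open_nbhd: "open (nbhd W r)"
  by (auto simp: nbhd_def)

section \<open>The uniform grid of the cube\<close>

definition grid_point :: "nat \<Rightarrow> ('d::finite \<Rightarrow> nat) \<Rightarrow> real^'d" where
  "grid_point N j = (\<chi> i. real (j i) / N)"

definition grid_cell :: "nat \<Rightarrow> ('d::finite \<Rightarrow> nat) \<Rightarrow> (real^'d) set" where
  "grid_cell N j = cbox (grid_point N j) (\<chi> i. real (Suc (j i)) / N)"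

lemma grid_point_in_cell: "grid_point N j \<in> grid_cell N j"
  by (auto simp: grid_cell_def grid_point_def mem_box_cart divide_right_mono)

lemma grid_point_in_cube:
  assumes "j \<in> UNIV \<rightarrow>\<^sub>E {..<N}"
  shows "grid_point N j \<in> unit_cube"
proof -
  have "j i < N" for i using assms by (auto simp: PiE_def)
  then show ?thesis
    by (force simp: grid_point_def mem_box_cart divide_le_eq less_imp_le)
qed

lemma grid_cells_cover:
  fixes x :: "real^'d"
  assumes "0 < N" "x \<in> unit_cube"
  obtains j where "j \<in> UNIV \<rightarrow>\<^sub>E {..<N}" "x \<in> grid_cell N j"
proof -
  \<comment> \<open>Ceiling minus one instead of floor gives the face \<open>x $ i = 1\<close> the
    index \<open>N - 1\<close>; at \<open>x $ i = 0\<close> the value -1 is truncated to 0 by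
    \<open>nat\<close>.\<close>
  define j where "j i = nat (\<lceil>N * x $ i\<rceil> - 1)" for i
  have x: "0 \<le> N * x $ i" "N * x $ i \<le> N" for i
    using assms by (auto simp: mem_box_cart mult_left_le)
  have "j i < N" for i
    using x[of i] \<open>0 < N\<close> unfolding j_def by linarith
  moreover have "real (j i) \<le> N * x $ i" "N * x $ i \<le> real (Suc (j i))" for i
    using x[of i] unfolding j_def by linarith+
  ultimately show ?thesis
    using \<open>0 < N\<close>
    by (intro that[of j]) (auto simp: grid_cell_def grid_point_def mem_box_cart field_simps)
qed

lemma grid_cell_dist_le:
  fixes x :: "real^'d"
  assumes "x \<in> grid_cell N j" "y \<in> grid_cell N j"
  shows "norm (x - y) \<le> CARD('d) / N"
proof -
  have "\<bar>(x - y) $ i\<bar> \<le> 1 / N" for i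
  proof -
    have "real (j i) / N \<le> x $ i" "x $ i \<le> real (j i) / N + 1 / N"
      "real (j i) / N \<le> y $ i" "y $ i \<le> real (j i) / N + 1 / N"
      using assms
      by (auto simp: grid_cell_def grid_point_def mem_box_cart add_divide_distrib add.commute)
    then show ?thesis by (simp add: abs_le_iff)
  qed
  then have "(\<Sum>i\<in>UNIV. \<bar>(x - y) $ i\<bar>) \<le> (\<Sum>i\<in>(UNIV::'d set). 1 / N)"
    by (intro sum_mono)
  then show ?thesis using norm_le_l1_cart[of "x - y"] by simp
qed

section \<open>Volume of thin tubes around \<open>W\<close>\<close>

text \<open>The manifold data with real Lipschitz constants instead of an extended infimum and
  supremum. Constants built from \<open>c\<close>, \<open>M\<close> and \<open>P\<close> depend only
  on \<open>W\<close> with its chart.\<close>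

locale bilipschitz_flattening =
  fixes W :: "(real^'m) set" and r :: real and \<phi> :: "real^'m \<Rightarrow> real^'m"
    and P :: "'m set" and c M :: real
  assumes r: "0 < r" and c: "0 < c" and M: "0 < M"
    and lower: "\<And>x y. x \<in> nbhd W r \<Longrightarrow> y \<in> nbhd W r \<Longrightarrow> c * norm (x - y) \<le> norm (\<phi> x - \<phi> y)"
    and upper: "\<And>x y. x \<in> nbhd W r \<Longrightarrow> y \<in> nbhd W r \<Longrightarrow> norm (\<phi> x - \<phi> y) \<le> M * norm (x - y)"
    and flat: "\<And>x i. x \<in> W \<Longrightarrow> i \<notin> P \<Longrightarrow> \<phi> x $ i = 0"
begin

text \<open>The first factor counts grid cubes; the rest is the volume of a ball of radius
  \<open>CARD('m) * \<tau> / c\<close>, divided by \<open>\<tau> ^ CARD('m)\<close>.\<close>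

definition tube_const :: real where
  "tube_const = (4 * M + 2) ^ CARD('m) * unit_ball_vol CARD('m) * (CARD('m) / c) ^ CARD('m)"

lemma tube_const_pos: "tube_const > 0"
  using c M by (simp add: tube_const_def)

text \<open>Under \<phi> the points \<open>z + v\<close> stay within \<open>M * \<tau>\<close> of 0
  in the coordinates outside \<open>P\<close> and vary by at most \<open>2 * M * \<rho>\<close> in
  those of \<open>P\<close>, so they meet about \<open>(\<rho> / \<tau>) ^ card P\<close> cubes of
  side \<tau>. By the lower Lipschitz bound each cube pulls back to a set of diameter of order
  \<tau>.\<close>

lemma emeasure_tube_le:
  assumes \<tau>: "0 < \<tau>" "\<tau> \<le> r" "\<tau> \<le> \<rho>"
  shows "emeasure lborel {v \<in> ball 0 \<rho>. z + v \<in> nbhd W \<tau>}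
    \<le> ennreal (tube_const * \<rho> ^ card P * \<tau> ^ (CARD('m) - card P))" (is "emeasure _ ?A \<le> _")
proof (cases "?A = {}")
  case True
  then show ?thesis by (simp only: emeasure_empty zero_le)
next
  case False
  \<comment> \<open>A point of the set serves as reference, since \<open>z\<close> itself may lie
    outside the domain of the chart.\<close>
  then obtain v0 where v0: "v0 \<in> ?A" by (meson ex_in_conv)
  define B where "B = 4 * M + 2"
  \<comment> \<open>\<open>q v\<close> labels the cube of side \<tau> containing
    \<open>\<phi> (z + v)\<close>, and \<open>J i\<close> is the range of its labels in coordinate
    \<open>i\<close>.\<close>
  define q where "q v i = \<lfloor>\<phi> (z + v) $ i / \<tau>\<rfloor>" for v i
  define J where "J i = (if i \<in> P
      then {\<lfloor>(\<phi> (z + v0) $ i - 2 * M * \<rho>) / \<tau>\<rfloor>..\<lfloor>(\<phi> (z + v0) $ i + 2 * M * \<rho>) / \<tau>\<rfloor>}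
      else {\<lfloor>-M\<rfloor>..\<lfloor>M\<rfloor>})" for i
  have W: "x \<in> nbhd W r" if "x \<in> W" for x
    using that r by (auto simp: nbhd_def intro!: bexI[of _ x])
  have tube: "z + v \<in> nbhd W r" if "v \<in> ?A" for v
    using that \<tau> by (force simp: nbhd_def)
  have comp: "\<bar>\<phi> x $ i - \<phi> y $ i\<bar> \<le> M * norm (x - y)" if "x \<in> nbhd W r" "y \<in> nbhd W r" for x y i
    using component_le_norm_cart[of "\<phi> x - \<phi> y" i] upper[OF that] by simp
  have qJ: "q v i \<in> J i" if v: "v \<in> ?A" for v i
  proof (cases "i \<in> P")
    case True
    have "norm (z + v - (z + v0)) \<le> 2 * \<rho>"
      using v v0 norm_triangle_ineq4[of v v0] by simp
    then have "M * norm (z + v - (z + v0)) \<le> M * (2 * \<rho>)" using M by (intro mult_left_mono) auto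
    with comp[OF tube[OF v] tube[OF v0], of i]
    have "\<bar>\<phi> (z + v) $ i - \<phi> (z + v0) $ i\<bar> \<le> 2 * M * \<rho>" by simp
    then show ?thesis using True \<tau>
      by (auto simp: J_def q_def abs_le_iff intro!: floor_mono divide_right_mono)
  next
    case False
    from v obtain w where w: "w \<in> W" "norm (z + v - w) < \<tau>"
      by (auto simp: nbhd_def dist_norm norm_minus_commute)
    have "\<bar>\<phi> (z + v) $ i\<bar> \<le> M * norm (z + v - w)"
      using comp[OF tube[OF v] W[OF w(1)], of i] flat[OF w(1) False] by simp
    also have "\<dots> \<le> M * \<tau>" using w M by (intro mult_left_mono) auto
    finally have "- M \<le> \<phi> (z + v) $ i / \<tau>" "\<phi> (z + v) $ i / \<tau> \<le> M"
      using \<tau> by (auto simp: field_simps abs_le_iff)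
    then show ?thesis using False by (auto simp: J_def q_def intro!: floor_mono)
  qed
  have dist: "dist v w \<le> CARD('m) * \<tau> / c" if vw: "v \<in> ?A" "w \<in> ?A" and eq: "q v = q w" for v w
  proof -
    have "\<bar>(\<phi> (z + v) - \<phi> (z + w)) $ i\<bar> \<le> \<tau>" for i
    proof -
      have "\<lfloor>\<phi> (z + v) $ i / \<tau>\<rfloor> = \<lfloor>\<phi> (z + w) $ i / \<tau>\<rfloor>"
        using fun_cong[OF eq, of i] by (simp add: q_def)
      then have "\<bar>\<phi> (z + v) $ i / \<tau> - \<phi> (z + w) $ i / \<tau>\<bar> \<le> 1" by linarith
      then have "\<bar>(\<phi> (z + v) - \<phi> (z + w)) $ i\<bar> / \<tau> \<le> 1"
        using \<tau> by (simp flip: diff_divide_distrib)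
      then show ?thesis using \<tau> by simp
    qed
    then have "(\<Sum>i\<in>UNIV. \<bar>(\<phi> (z + v) - \<phi> (z + w)) $ i\<bar>) \<le> (\<Sum>i\<in>(UNIV::'m set). \<tau>)"
      by (intro sum_mono)
    then have "norm (\<phi> (z + v) - \<phi> (z + w)) \<le> CARD('m) * \<tau>"
      using norm_le_l1_cart[of "\<phi> (z + v) - \<phi> (z + w)"] by simp
    then have "c * dist v w \<le> CARD('m) * \<tau>"
      using lower[OF tube[OF vw(1)] tube[OF vw(2)]] by (simp add: dist_norm)
    then show ?thesis using c by (simp add: field_simps)
  qed
  have B: "B > 0" and "\<rho> > 0" using M \<tau> by (auto simp: B_def)
  \<comment> \<open>\<open>B\<close> serves both cases: \<open>\<tau> \<le> \<rho>\<close> absorbs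
    the rounding term 2 for \<open>i \<in> P\<close>, and \<open>2 * M + 2 \<le> B\<close>
    otherwise.\<close>
  have cardJ: "real (card (J i)) \<le> B * (if i \<in> P then \<rho> / \<tau> else 1)" for i
  proof (cases "i \<in> P")
    case True
    have "real (card (J i)) \<le> (\<phi> (z + v0) $ i + 2 * M * \<rho>) / \<tau> - (\<phi> (z + v0) $ i - 2 * M * \<rho>) / \<tau> + 2"
      using True M \<tau> \<open>\<rho> > 0\<close> unfolding J_def
      by (simp only: if_True) (intro card_floor_interval divide_right_mono, auto)
    also have "\<dots> = 4 * M * (\<rho> / \<tau>) + 2"
      by (simp add: add_divide_distrib diff_divide_distrib)
    also have "\<dots> \<le> B * (\<rho> / \<tau>)" using \<tau> by (simp add: B_def field_simps)
    finally show ?thesis using True by simp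
  next
    case False
    then show ?thesis using M card_floor_interval[of "-M" M] by (simp add: J_def B_def)
  qed
  have "card (PiE UNIV J) = (\<Prod>i\<in>UNIV. card (J i))"
    by (simp add: card_PiE)
  then have "real (card (PiE UNIV J)) = (\<Prod>i\<in>UNIV. real (card (J i)))"
    by simp
  also have "\<dots> \<le> (\<Prod>i\<in>UNIV. B * (if i \<in> P then \<rho> / \<tau> else 1))"
    using cardJ by (intro prod_mono) auto
  also have "\<dots> = B ^ CARD('m) * (\<rho> / \<tau>) ^ card P"
    by (simp add: prod.distrib prod.If_cases)
  finally have card: "real (card (PiE UNIV J)) \<le> B ^ CARD('m) * (\<rho> / \<tau>) ^ card P" .
  have "emeasure lborel ?A \<le> ennreal (real (card (PiE UNIV J)) *
      (unit_ball_vol (DIM(real^'m)) * (CARD('m) * \<tau> / c) ^ DIM(real^'m)))"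
  proof (rule emeasure_le_card_fibres)
    show "finite (PiE UNIV J)" by (intro finite_PiE) (auto simp: J_def)
    show "q ` ?A \<subseteq> PiE UNIV J" using qJ by (auto simp: PiE_def)
    show "0 \<le> CARD('m) * \<tau> / c" using c \<tau> by simp
    show "dist v w \<le> CARD('m) * \<tau> / c" if "v \<in> ?A" "w \<in> ?A" "q v = q w" for v w
      by (rule dist[OF that])
  qed
  also have "\<dots> \<le> ennreal (B ^ CARD('m) * (\<rho> / \<tau>) ^ card P *
      (unit_ball_vol CARD('m) * (CARD('m) * \<tau> / c) ^ CARD('m)))"
    using c \<tau> by (intro ennreal_leI) (simp add: mult_right_mono card)
  also have "B ^ CARD('m) * (\<rho> / \<tau>) ^ card P * (unit_ball_vol CARD('m) * (CARD('m) * \<tau> / c) ^ CARD('m))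
     = tube_const * \<rho> ^ card P * \<tau> ^ (CARD('m) - card P)"
  proof -
    have "\<tau> ^ CARD('m) = \<tau> ^ card P * \<tau> ^ (CARD('m) - card P)"
      by (simp flip: power_add add: card_mono)
    then show ?thesis
      using \<tau> by (simp add: tube_const_def B_def power_divide power_mult_distrib)
  qed
  finally show ?thesis .
qed

section \<open>Averaging over translates\<close>

text \<open>The quotient \<open>2 * T / V\<close> of the averaging argument below without its power
  of \<open>K / \<rho>\<close>. The leading 2 is the loss against the average; the power of
  \<open>2 * d\<close> comes from the tube radius.\<close>

definition translate_const :: "nat \<Rightarrow> nat \<Rightarrow> real" where
  "translate_const d n = 2 * unit_ball_vol n * d ^ n * tube_const * (2 * d) ^ (CARD('m) - card P)
     / unit_ball_vol CARD('m)"

lemma translate_const_pos: "0 < d \<Longrightarrow> 0 < translate_const d n"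
  using tube_const_pos by (simp add: translate_const_def)

text \<open>There are \<open>N ^ CARD('d)\<close> cells, each of weight of order
  \<open>N ^ n\<close> in the denominator and hit by a set of translates whose volume has
  \<open>N ^ (CARD('m) - card P)\<close> in the denominator. By \<open>n\<close> the powers of
  \<open>N\<close> cancel, so the average stays bounded as the mesh shrinks.\<close>

lemma exists_translate_small_preimage:
  fixes f :: "real^'d \<Rightarrow> real^'m"
  assumes f: "K-lipschitz_on unit_cube f" and K: "0 < K" and \<rho>: "0 < \<rho>"
    and n: "n + (CARD('m) - card P) = CARD('d)"
  shows "\<exists>v\<in>ball 0 \<rho>. hausdorff_measure (real n) (preimage_set W (\<lambda>x. f x + v))
    \<le> ennreal (translate_const CARD('d) n * (K / \<rho>) ^ (CARD('m) - card P))"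
proof -
  define D where "D = real CARD('d)"
  define k where "k = CARD('m) - card P"
  \<comment> \<open>Twice the bound \<open>K * D / N\<close> for the oscillation of \<open>f\<close>
    on a cell, which leaves room for the strict inequality defining the open tube.\<close>
  define \<tau> where "\<tau> N = 2 * K * D / real N" for N
  define I where "I N = ((UNIV :: 'd set) \<rightarrow>\<^sub>E {..<N})" for N :: nat
  define A where "A N j = {v \<in> ball 0 \<rho>. f (grid_point N j) + v \<in> nbhd W (\<tau> N)}" for N j
  define w where "w N = unit_ball_vol n * (D / real N) ^ n" for N
  \<comment> \<open>Total weight of the cells whose corner is sent into the tube by
    \<open>f + v\<close>; \<open>T\<close> will bound its integral for all large \<open>N\<close>,
    and \<open>V\<close> is the volume of the ball of translates.\<close>
  define u where "u N v = (\<Sum>j\<in>I N. ennreal (w N) * indicator (A N j) v)" for N v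
  define T where "T = unit_ball_vol n * D ^ n * tube_const * \<rho> ^ card P * (2 * K * D) ^ k"
  define V where "V = unit_ball_vol CARD('m) * \<rho> ^ CARD('m)"
  have D: "D > 0" by (simp add: D_def)
  have T: "T > 0" and V: "V > 0"
    using D K \<rho> tube_const_pos by (auto simp: T_def V_def)
  have finI: "finite (I N)" for N by (auto simp: I_def intro: finite_PiE)
  have w0: "w N \<ge> 0" for N using D by (simp add: w_def)
  have lim: "(\<lambda>N. a / real N) \<longlonglongrightarrow> 0" for a
    by (rule lim_const_over_n)
  \<comment> \<open>The tube is open whatever \<open>W\<close> is, so \<open>u N\<close> is Borel,
    as Fatou's lemma requires.\<close>
  have A_meas: "A N j \<in> sets lborel" for N j
  proof -
    have "open ((\<lambda>v. f (grid_point N j) + v) -` nbhd W (\<tau> N))"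
      by (intro open_vimage open_nbhd continuous_intros)
    moreover have "A N j = ball 0 \<rho> \<inter> (\<lambda>v. f (grid_point N j) + v) -` nbhd W (\<tau> N)"
      by (auto simp: A_def)
    ultimately show ?thesis by (simp add: open_Int)
  qed

  have premeasure: "hausdorff_premeasure (real n) (D / N) (preimage_set W (\<lambda>x. f x + v)) \<le> u N v"
    if N: "0 < N" and v: "v \<in> ball 0 \<rho>" for N v
  proof -
    define J where "J = {j \<in> I N. v \<in> A N j}"
    have cover: "preimage_set W (\<lambda>x. f x + v) \<subseteq> (\<Union>j\<in>J. grid_cell N j)"
    proof
      fix x assume "x \<in> preimage_set W (\<lambda>x. f x + v)"
      then have x: "x \<in> unit_cube" and fx: "f x + v \<in> W" by (auto simp: preimage_set_def)
      obtain j where j: "j \<in> I N" and xj: "x \<in> grid_cell N j"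
        using grid_cells_cover[OF N x] unfolding I_def by blast
      have "dist (f x + v) (f (grid_point N j) + v) \<le> K * dist x (grid_point N j)"
        using lipschitz_onD[OF f x grid_point_in_cube] j by (simp add: I_def)
      also have "\<dots> \<le> K * (D / N)"
        using grid_cell_dist_le[OF xj grid_point_in_cell] K
        by (intro mult_left_mono) (auto simp: dist_norm D_def)
      also have "\<dots> < \<tau> N" using K D N by (simp add: \<tau>_def field_simps)
      finally have "f (grid_point N j) + v \<in> nbhd W (\<tau> N)"
        using fx unfolding nbhd_def by force
      then have "j \<in> J" using v j by (simp add: J_def A_def)
      with xj show "x \<in> (\<Union>j\<in>J. grid_cell N j)" by blast
    qed
    have diam: "diameter (grid_cell N j) \<le> D / N" for j :: "'d \<Rightarrow> nat"
      using grid_cell_dist_le D by (intro diameter_le) (auto simp: D_def)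
    have "hausdorff_premeasure (real n) (D / N) (preimage_set W (\<lambda>x. f x + v))
        \<le> (\<Sum>j\<in>J. hausdorff_weight (real n) (grid_cell N j))"
      using finI cover diam D
      by (intro hausdorff_premeasure_le_sum) (auto simp: J_def grid_cell_def)
    also have "\<dots> \<le> (\<Sum>j\<in>J. ennreal (w N))"
    proof (rule sum_mono)
      fix j :: "'d \<Rightarrow> nat"
      have "0 \<le> diameter (grid_cell N j)"
        by (intro diameter_ge_0) (simp add: grid_cell_def)
      \<comment> \<open>The factor 1/2 is given away to match the definition of
        \<open>w\<close>.\<close>
      moreover from this have "diameter (grid_cell N j) / 2 \<le> D / N"
        using diam[of j] by linarith
      moreover from calculation have "(diameter (grid_cell N j) / 2) ^ n \<le> (D / N) ^ n"
        by (intro power_mono) auto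
      ultimately show "hausdorff_weight (real n) (grid_cell N j) \<le> ennreal (w N)"
        by (auto simp: hausdorff_weight_def w_def rpow_of_nat intro!: ennreal_leI mult_left_mono)
    qed
    also have "\<dots> = (\<Sum>j\<in>I N. if v \<in> A N j then ennreal (w N) else 0)"
      unfolding J_def by (rule sum.inter_filter[OF finI])
    also have "\<dots> = u N v"
      unfolding u_def by (intro sum.cong) (auto simp: indicator_def)
    finally show ?thesis .
  qed

  have H_le: "hausdorff_measure (real n) (preimage_set W (\<lambda>x. f x + v)) \<le> liminf (\<lambda>N. u N v)"
    if "v \<in> ball 0 \<rho>" for v
    using premeasure[OF _ that]
    by (intro hausdorff_measure_le_liminf[OF lim[of D]] eventually_mono[OF eventually_gt_at_top[of 0]])

  have integral_u: "(\<integral>\<^sup>+v. u N v \<partial>lborel) \<le> ennreal T" if N: "0 < N" "\<tau> N < r" "\<tau> N < \<rho>" for N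
  proof -
    define B where "B = tube_const * \<rho> ^ card P * \<tau> N ^ k"
    have "0 < \<tau> N" using N K D by (simp add: \<tau>_def)
    then have "emeasure lborel (A N j) \<le> ennreal B" for j
      unfolding A_def B_def k_def using N by (intro emeasure_tube_le) auto
    moreover have "(\<integral>\<^sup>+v. u N v \<partial>lborel) = (\<Sum>j\<in>I N. ennreal (w N) * emeasure lborel (A N j))"
      unfolding u_def using A_meas
      by (subst nn_integral_sum) (auto simp: nn_integral_cmult_indicator)
    ultimately have "(\<integral>\<^sup>+v. u N v \<partial>lborel) \<le> (\<Sum>j\<in>I N. ennreal (w N) * ennreal B)"
      by (simp only:) (intro sum_mono mult_left_mono, auto)
    also have "\<dots> = ennreal (real (card (I N)) * (w N * B))"
      using w0 by (simp add: ennreal_mult' ennreal_of_nat_eq_real_of_nat)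
    also have "real (card (I N)) * (w N * B) = T"
    proof -
      have "real (card (I N)) = real N ^ n * real N ^ k"
        using n by (simp add: I_def card_PiE k_def flip: power_add)
      then show ?thesis
        using N by (simp add: w_def B_def T_def \<tau>_def power_divide)
    qed
    finally show ?thesis .
  qed

  have "\<forall>\<^sub>F N in sequentially. 0 < N \<and> \<tau> N < r \<and> \<tau> N < \<rho>"
    using order_tendstoD(2)[OF lim r, of "2 * K * D"] order_tendstoD(2)[OF lim \<rho>, of "2 * K * D"]
      eventually_gt_at_top[of 0]
    unfolding \<tau>_def by (intro eventually_conj)
  then have "\<forall>\<^sub>F N in sequentially. (\<integral>\<^sup>+v. u N v \<partial>lborel) \<le> ennreal T"
    by eventually_elim (use integral_u in auto)
  then have "liminf (\<lambda>N. \<integral>\<^sup>+v. u N v \<partial>lborel) \<le> liminf (\<lambda>N::nat. ennreal T)"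
    by (rule Liminf_mono)
  then have fatou: "(\<integral>\<^sup>+v. liminf (\<lambda>N. u N v) \<partial>lborel) \<le> ennreal T"
    using A_meas
    by (intro order.trans[OF nn_integral_liminf]) (auto simp: Liminf_const u_def)

  have "\<exists>v\<in>ball 0 \<rho>. hausdorff_measure (real n) (preimage_set W (\<lambda>x. f x + v)) \<le> ennreal (2 * T / V)"
  proof (rule ccontr)
    assume contra: "\<not> ?thesis"
    \<comment> \<open>Only the Borel function liminf of \<open>u N\<close> is integrated, which
      avoids the question whether the Hausdorff measure depends measurably on
      \<open>v\<close>.\<close>
    have "ennreal (2 * T / V) * indicator (ball 0 \<rho>) v \<le> liminf (\<lambda>N. u N v)" for v
    proof (cases "v \<in> ball 0 \<rho>")
      case True
      with contra have "ennreal (2 * T / V) \<le> hausdorff_measure (real n) (preimage_set W (\<lambda>x. f x + v))"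
        by (meson nle_le)
      also note H_le[OF True]
      finally show ?thesis using True by (simp add: indicator_def)
    qed (simp add: indicator_def)
    then have "(\<integral>\<^sup>+v. ennreal (2 * T / V) * indicator (ball 0 \<rho>) (v :: real^'m) \<partial>lborel) \<le> ennreal T"
      by (intro order.trans[OF nn_integral_mono fatou])
    moreover have "emeasure lborel (ball (0 :: real^'m) \<rho>) = ennreal V"
      using \<rho> by (simp add: emeasure_ball V_def)
    ultimately have "ennreal (2 * T / V) * ennreal V \<le> ennreal T"
      by (simp add: nn_integral_cmult_indicator)
    then have "ennreal (2 * T) \<le> ennreal T"
      using T V by (simp flip: ennreal_mult')
    with T show False by (simp add: ennreal_le_iff2)
  qed
  moreover have "2 * T / V = translate_const CARD('d) n * (K / \<rho>) ^ (CARD('m) - card P)"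
  proof -
    have "\<rho> ^ CARD('m) = \<rho> ^ card P * \<rho> ^ k"
      by (simp add: k_def card_mono flip: power_add)
    then show ?thesis
      using \<rho> by (simp add: T_def V_def translate_const_def D_def k_def power_mult_distrib power_divide)
  qed
  ultimately show ?thesis by simp
qed

section \<open>The estimate for Hoelder functions\<close>

text \<open>Any positive Hoelder constant \<open>L\<close> is allowed in place of the norm, so that
  it can tend to 0 when the norm vanishes. The 2 in the constant comes from halving
  \<epsilon>.\<close>

lemma min_preimage_measure_le:
  fixes g :: "real^'d \<Rightarrow> real^'m"
  assumes g: "\<And>x y. x \<in> unit_cube \<Longrightarrow> y \<in> unit_cube \<Longrightarrow> norm (g x - g y) \<le> L * norm (x - y) powr \<alpha>"
    and pos: "0 < L" "0 < \<epsilon>" "0 < \<alpha>" "\<alpha> \<le> 1"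
    and dim: "n + (CARD('m) - card P) = CARD('d)"
    and e: "e = real (CARD('m) - card P) / \<alpha>"
  shows "min_preimage_measure (card P) W g \<epsilon>
    \<le> ennreal (translate_const CARD('d) n * (2 * CARD('m)) powr e * (L / \<epsilon>) powr e)"
proof -
  define \<rho> where "\<rho> = \<epsilon> / 2"
  define K where "K = \<rho> * (real CARD('m) * L / \<rho>) powr (1 / \<alpha>)"
  have \<rho>: "\<rho> > 0" using pos by (simp add: \<rho>_def)
  obtain f where f: "K-lipschitz_on unit_cube f" "\<And>x. x \<in> unit_cube \<Longrightarrow> norm (f x - g x) \<le> \<rho>"
    using lipschitz_approx_of_holder_cart[of L \<rho> \<alpha> unit_cube g] g pos \<rho>
    unfolding K_def dist_norm by metis
  have K: "K > 0" using \<rho> pos by (simp add: K_def)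
  from exists_translate_small_preimage[OF f(1) K \<rho> dim]
  obtain v where v: "norm v < \<rho>" "hausdorff_measure (real n) (preimage_set W (\<lambda>x. f x + v))
      \<le> ennreal (translate_const CARD('d) n * (K / \<rho>) ^ (CARD('m) - card P))"
    by auto
  have "norm (f x + v - g x) \<le> \<epsilon>" if "x \<in> unit_cube" for x
    using norm_triangle_ineq[of "f x - g x" v] f(2)[OF that] v(1)
    by (simp add: \<rho>_def algebra_simps)
  moreover have "(unit_cube :: (real^'d) set) \<noteq> {}" by (simp add: interval_ne_empty_cart)
  ultimately have "cube_sup_norm (\<lambda>x. f x + v - g x) \<le> \<epsilon>"
    unfolding cube_sup_norm_def by (intro cSUP_least) auto
  moreover have "continuous_on unit_cube (\<lambda>x. f x + v)"
    using f(1) by (intro continuous_intros lipschitz_on_continuous_on)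
  moreover have "real CARD('d) + real (card P) - real CARD('m) = real n"
    using dim card_mono[of UNIV P] by (simp add: of_nat_diff flip: dim)
  ultimately have "min_preimage_measure (card P) W g \<epsilon>
      \<le> hausdorff_measure (real n) (preimage_set W (\<lambda>x. f x + v))"
    unfolding min_preimage_measure_def by (intro INF_lower2[of "\<lambda>x. f x + v"]) auto
  also note v(2)
  also have "(K / \<rho>) ^ (CARD('m) - card P) = (2 * CARD('m)) powr e * (L / \<epsilon>) powr e"
  proof -
    have "(K / \<rho>) ^ (CARD('m) - card P) = (real CARD('m) * L / \<rho>) powr e"
      using \<rho> pos by (simp add: K_def e powr_powr flip: powr_realpow)
    also have "real CARD('m) * L / \<rho> = (2 * CARD('m)) * (L / \<epsilon>)"
      by (simp add: \<rho>_def)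
    also have "\<dots> powr e = (2 * CARD('m)) powr e * (L / \<epsilon>) powr e"
      by (rule powr_mult)
    finally show ?thesis .
  qed
  finally show ?thesis by (simp add: mult.assoc)
qed

end

section \<open>Chart constants, the Hoelder norm and the conclusion\<close>

lemma global_C1_manifold_flattening:
  assumes "global_C1_manifold p W r \<phi>"
  obtains P c M where "card P = p" "bilipschitz_flattening W r \<phi> P c M"
proof -
  define X where "X = {(x, y). x \<in> nbhd W r \<and> y \<in> nbhd W r \<and> x \<noteq> y}"
  define q where "q = (\<lambda>(x, y). ennreal (norm (\<phi> x - \<phi> y) / norm (x - y)))"
  from assms obtain P where P: "card P = p" "\<phi> ` W \<subseteq> {y. \<forall>i. i \<notin> P \<longrightarrow> y $ i = 0}"
    and r: "r > 0" and inf: "0 < (INF z\<in>X. q z)" and sup: "(SUP z\<in>X. q z) < \<infinity>"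
    unfolding global_C1_manifold_def X_def q_def by blast
  \<comment> \<open>A value strictly below the infimum is finite even for empty \<open>W\<close>,
    where the infimum is infinite.\<close>
  obtain c' where c': "0 < c'" "c' < (INF z\<in>X. q z)" using inf dense by blast
  define c where "c = enn2real c'"
  \<comment> \<open>Adding 1 keeps \<open>M\<close> positive when \<open>W\<close> is empty and the
    supremum is 0.\<close>
  define M where "M = enn2real (SUP z\<in>X. q z) + 1"
  have c: "c' = ennreal c" "0 < c"
    using c' by (auto simp: c_def enn2real_positive_iff less_top[symmetric] top.extremum_strict
        dest: less_le_trans[OF _ top_greatest])
  have M: "(SUP z\<in>X. q z) \<le> ennreal M" "0 < M"
    using sup by (auto simp: M_def ennreal_plus add_nonneg_pos)
  have "bilipschitz_flattening W r \<phi> P c M"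
  proof
    fix x y assume xy: "x \<in> nbhd W r" "y \<in> nbhd W r"
    show "c * norm (x - y) \<le> norm (\<phi> x - \<phi> y)"
    proof (cases "x = y")
      case False
      then have "(INF z\<in>X. q z) \<le> q (x, y)"
        using xy by (intro INF_lower) (auto simp: X_def)
      then have "ennreal c \<le> q (x, y)"
        using c'(2) c(1) by order
      then show ?thesis using False by (simp add: q_def ennreal_le_iff field_simps)
    qed simp
    show "norm (\<phi> x - \<phi> y) \<le> M * norm (x - y)"
    proof (cases "x = y")
      case False
      then have "q (x, y) \<le> ennreal M"
        using xy by (intro order.trans[OF SUP_upper M(1)]) (auto simp: X_def)
      then show ?thesis using False M(2) by (simp add: q_def ennreal_le_iff field_simps)
    qed simp
  qed (use r c M P in auto)
  with P show ?thesis using that by blast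
qed

text \<open>Hoelder continuity bounds the quotients above, so the real supremum in
  \<open>holder_norm\<close> is a genuine one.\<close>

lemma norm_diff_le_holder_norm:
  fixes g :: "real^'d \<Rightarrow> real^'m"
  assumes "holder_continuous \<alpha> g" "x \<in> unit_cube" "y \<in> unit_cube"
  shows "norm (g x - g y) \<le> holder_norm \<alpha> g * norm (x - y) powr \<alpha>"
proof (cases "x = y")
  case False
  define X where "X = {(x :: real^'d, y). x \<in> unit_cube \<and> y \<in> unit_cube \<and> x \<noteq> y}"
  define q where "q = (\<lambda>(x, y). norm (g x - g y) / norm (x - y) powr \<alpha>)"
  from assms obtain L where
    L: "\<And>x y. x \<in> unit_cube \<Longrightarrow> y \<in> unit_cube \<Longrightarrow> norm (g x - g y) \<le> L * norm (x - y) powr \<alpha>"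
    unfolding holder_continuous_def by blast
  then have "bdd_above (q ` X)"
    by (intro bdd_aboveI2[of _ _ L]) (auto simp: X_def q_def divide_le_eq)
  then have "q (x, y) \<le> (SUP z\<in>X. q z)"
    using assms False by (intro cSUP_upper) (auto simp: X_def)
  then show ?thesis
    using False by (simp add: q_def X_def holder_norm_def divide_le_eq)
qed simp

lemma holder_norm_nonneg:
  fixes g :: "real^'d \<Rightarrow> real^'m"
  assumes "holder_continuous \<alpha> g"
  shows "0 \<le> holder_norm \<alpha> g"
proof -
  \<comment> \<open>Two distinct points of the cube, so the bound between them has a positive factor
    next to the norm.\<close>
  have "(0 :: real^'d) \<in> unit_cube" "(1 :: real^'d) \<in> unit_cube"
    by (auto simp: mem_box_cart)
  from norm_diff_le_holder_norm[OF assms this]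
  have "0 \<le> holder_norm \<alpha> g * norm (0 - 1 :: real^'d) powr \<alpha>"
    by (rule order.trans[OF norm_ge_zero])
  moreover have "0 < norm (0 - 1 :: real^'d) powr \<alpha>" by simp
  ultimately show ?thesis by (simp only: zero_le_mult_iff) linarith
qed

theorem theorem1p1:
  fixes W :: "(real^'m) set" and r :: real and \<phi> :: "real^'m \<Rightarrow> real^'m"
    and p :: nat and \<alpha> :: real
  assumes "p \<le> CARD('m)"
    and "p + CARD('d::finite) \<ge> CARD('m)"
    and "0 < \<alpha>" and "\<alpha> \<le> 1"
    and "global_C1_manifold p W r \<phi>"
  shows "\<exists>C>0. \<forall>g :: real^'d \<Rightarrow> real^'m. holder_continuous \<alpha> g \<longrightarrow>
           (\<exists>\<epsilon>\<^sub>0>0. \<forall>\<epsilon>. 0 < \<epsilon> \<and> \<epsilon> < \<epsilon>\<^sub>0 \<longrightarrow>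
              min_preimage_measure p W g \<epsilon>
                \<le> ennreal (C * rpow (holder_norm \<alpha> g / \<epsilon>) ((real CARD('m) - real p) / \<alpha>)))"
proof -
  obtain P c M where P: "card P = p" and "bilipschitz_flattening W r \<phi> P c M"
    using global_C1_manifold_flattening[OF assms(5)] .
  then interpret bilipschitz_flattening W r \<phi> P c M by simp
  define e where "e = (real CARD('m) - real p) / \<alpha>"
  define n where "n = p + CARD('d) - CARD('m)"
  define C where "C = translate_const CARD('d) n * (2 * CARD('m)) powr e"
  have C: "C > 0" by (simp add: C_def translate_const_pos)
  have "e \<ge> 0" using assms by (simp add: e_def)
  have "min_preimage_measure p W g \<epsilon> \<le> ennreal (C * rpow (holder_norm \<alpha> g / \<epsilon>) e)"
    if g: "holder_continuous \<alpha> g" and "0 < \<epsilon>" for g :: "real^'d \<Rightarrow> real^'m" and \<epsilon>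
  proof -
    have bound: "min_preimage_measure p W g \<epsilon> \<le> ennreal (C * (L / \<epsilon>) powr e)"
      if "0 < L" "holder_norm \<alpha> g \<le> L" for L
      unfolding C_def P[symmetric]
    proof (rule min_preimage_measure_le)
      show "norm (g x - g y) \<le> L * norm (x - y) powr \<alpha>" if "x \<in> unit_cube" "y \<in> unit_cube" for x y
        using norm_diff_le_holder_norm[OF g that] mult_right_mono[OF \<open>holder_norm \<alpha> g \<le> L\<close>]
        by (rule order.trans) simp
    qed (use assms that \<open>0 < \<epsilon>\<close> P in \<open>auto simp: n_def e_def of_nat_diff\<close>)
    \<comment> \<open>If the norm is 0, \<open>rpow\<close> decides: for \<open>e = 0\<close> its
      value is 1 and any \<open>L\<close> will do; for \<open>e > 0\<close> the right-hand side is
      0.\<close>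
    consider "holder_norm \<alpha> g > 0" | "holder_norm \<alpha> g = 0" "e = 0" | "holder_norm \<alpha> g = 0" "e > 0"
      using holder_norm_nonneg[OF g] \<open>e \<ge> 0\<close> by linarith
    then show ?thesis
    proof cases
      case 1
      then show ?thesis using bound[of "holder_norm \<alpha> g"] \<open>0 < \<epsilon>\<close> by (auto simp: rpow_def)
    next
      case 2
      then show ?thesis using bound[of 1] \<open>0 < \<epsilon>\<close> by (auto simp: rpow_def)
    next
      case 3
      have "min_preimage_measure p W g \<epsilon> \<le> 0"
      proof (rule ennreal_le_epsilon)
        fix y :: real assume "0 < y"
        \<comment> \<open>This \<open>L\<close> solves
          \<open>C * (L / \<epsilon>) powr e = y\<close>.\<close>
        then show "min_preimage_measure p W g \<epsilon> \<le> 0 + ennreal y"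
          using bound[of "\<epsilon> * (y / C) powr (1 / e)"] 3 C \<open>0 < \<epsilon>\<close> by (simp add: powr_powr)
      qed
      then show ?thesis by simp
    qed
  qed
  \<comment> \<open>The inequality is available for every positive \<epsilon>, so the threshold 1 is
    an arbitrary choice.\<close>
  then show ?thesis
    unfolding e_def using C by (intro exI[of _ C]) (auto intro!: exI[of _ 1])
qed

end
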